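(* Any streaming algorithm for \textsc{Connectivity} in the VA model that works on a family of graphs including all split graphs and uses $p$ passes over the stream requires $\Omega(n/p)$ bits of memory on $n$-vertex graphs.
   Context: A split graph is a graph whose vertex set can be partitioned into a clique and an independent set. \textsc{Connectivity}: decide whether the graph is connected. In the Vertex Arrival (VA) streaming model, vertices arrive one by one in arbitrary fixed order and each edge is revealed when the later of its two endpoints arrives. A $p$-pass algorithm reads the stream $p$ times with unlimited computation; memory is in bits. "Requires $\Omega(f)$ bits" means there is a constant $c>0$ such that every such algorithm uses at least $cf$ bits on some $n$-vertex input of the class, for all sufficiently large $n$ and all $p$. *)

theory Defs
  imports Complex_Main "Graph_Theory.Graph_Theory"
begin

text \<open>
  A finite simple undirected graph is a \<open>pair_graph\<close>: a finite, loop-free, symmetric digraph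
  without parallel arcs. The vertex labels of an \<open>n\<close>-vertex graph are fixed to be \<open>0, \<dots>, n - 1\<close>;
  with an unbounded supply of labels there would be infinitely many \<open>n\<close>-vertex inputs, and memory
  bounds could hold merely because labels are expensive to store.
\<close>

definition labelled_graphs :: "nat pair_pre_digraph set" where
  "labelled_graphs = {G. pair_graph G \<and> pverts G = {..<card (pverts G)}}"

definition is_split :: "'v pair_pre_digraph \<Rightarrow> bool" where
  "is_split G \<longleftrightarrow> (\<exists>K I. K \<union> I = pverts G \<and> K \<inter> I = {} \<and>
     (\<forall>u\<in>K. \<forall>v\<in>K. u \<noteq> v \<longrightarrow> (u, v) \<in> parcs G) \<and>
     (\<forall>u\<in>I. \<forall>v\<in>I. (u, v) \<notin> parcs G))"

definition split_graphs :: "nat pair_pre_digraph set" where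
  "split_graphs = {G \<in> labelled_graphs. is_split G}"

definition arrival_order :: "'v pair_pre_digraph \<Rightarrow> 'v list \<Rightarrow> bool" where
  "arrival_order G vs \<longleftrightarrow> distinct vs \<and> set vs = pverts G"

text \<open>
  In the vertex arrival model, one stream item is an arriving vertex together with its neighbours
  among the vertices that arrived before it. Handing over all edges of the arriving vertex at once
  is the most generous reading: an algorithm that reads them one at a time, in any order, can be
  run on such items without using more memory.
\<close>

definition va_stream :: "'v pair_pre_digraph \<Rightarrow> 'v list \<Rightarrow> ('v \<times> 'v set) list" where
  "va_stream G vs =
     map (\<lambda>i. (vs ! i, {u \<in> set (take i vs). (u, vs ! i) \<in> parcs G})) [0..<length vs]"

text \<open>
  A deterministic streaming algorithm with unlimited computational power: arbitrary functions
  acting on a memory content, which is a bit string of variable length. The first argument of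
  \<open>step\<close> is the number of items read so far, over all passes. So on \<open>n\<close>-vertex inputs the current
  pass and the position in it are known without being charged to the memory.
\<close>

record 'i streaming_alg =
  initial :: "bool list"
  step :: "nat \<Rightarrow> 'i \<Rightarrow> bool list \<Rightarrow> bool list"
  answer :: "bool list \<Rightarrow> bool"

text \<open>
  The memory content after \<open>t\<close> items, when the stream \<open>\<sigma>\<close> is read repeatedly in the same order.
\<close>

primrec memory_after :: "'i streaming_alg \<Rightarrow> 'i list \<Rightarrow> nat \<Rightarrow> bool list" where
  "memory_after A \<sigma> 0 = initial A"
| "memory_after A \<sigma> (Suc t) = step A t (\<sigma> ! (t mod length \<sigma>)) (memory_after A \<sigma> t)"

definition result :: "'i streaming_alg \<Rightarrow> nat \<Rightarrow> 'i list \<Rightarrow> bool" where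
  "result A p \<sigma> = answer A (memory_after A \<sigma> (p * length \<sigma>))"

definition memory_bits :: "'i streaming_alg \<Rightarrow> nat \<Rightarrow> 'i list \<Rightarrow> nat" where
  "memory_bits A p \<sigma> = Max ((\<lambda>t. length (memory_after A \<sigma> t)) ` {0..p * length \<sigma>})"

definition decides_connectivity ::
  "(nat \<times> nat set) streaming_alg \<Rightarrow> nat \<Rightarrow> nat pair_pre_digraph set \<Rightarrow> bool" where
  "decides_connectivity A p \<G> \<longleftrightarrow>
     (\<forall>G\<in>\<G>. \<forall>vs. arrival_order G vs \<longrightarrow>
        (result A p (va_stream G vs) \<longleftrightarrow> connected (with_proj G)))"

end

theory Submission
  imports Defs
begin

text \<open>
  Let the independent vertices \<open>0, \<dots>, k - 1\<close> arrive first, then a vertex \<open>k\<close> adjacent to a set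
  \<open>X\<close> of them, then a vertex \<open>k + 1\<close> adjacent to \<open>k\<close> and to a set \<open>Y\<close> of them. This split graph is
  connected iff \<open>X \<union> Y = {..<k}\<close>, and only the last item of its stream depends on \<open>Y\<close>. Hence the
  \<open>2\<^sup>k\<close> pairs \<open>(X, {..<k} - X)\<close> form a fooling set: the algorithm must distinguish them by the
  memory contents at the \<open>2 p\<close> moments when the stream switches between the two parts.
\<close>

section \<open>Mixing the two parts of two streams\<close>

lemma memory_after_cong:
  assumes "length \<sigma> = length \<tau>" and "t \<le> t'"
    and "memory_after A \<sigma> t = memory_after A \<tau> t"
    and "\<And>i. t \<le> i \<Longrightarrow> i < t' \<Longrightarrow> \<sigma> ! (i mod length \<sigma>) = \<tau> ! (i mod length \<sigma>)"
  shows "memory_after A \<sigma> t' = memory_after A \<tau> t'"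
  using assms(2,4)
proof (induction rule: dec_induct)
  case base
  then show ?case using assms(3) by simp
next
  case (step i)
  then show ?case using assms(1) by simp
qed

text \<open>Induction over the passes. While it reads \<open>\<alpha>\<close>, the mixed stream
  \<open>\<alpha> @ \<beta>'\<close> follows the run on \<open>\<alpha> @ \<beta>\<close>. At the
  switch inside the pass, \<open>mid\<close> lets it change over to the run on
  \<open>\<alpha>' @ \<beta>'\<close>, whose second part it reads next. At the end of the pass,
  \<open>fin\<close> brings it back to the first run.\<close>

lemma memory_after_exchange:
  assumes m: "length \<alpha> = m" "length \<alpha>' = m" and n: "m + length \<beta> = n" "m + length \<beta>' = n"
    and mid: "\<And>j. j < p \<Longrightarrow>
      memory_after A (\<alpha> @ \<beta>) (j * n + m) = memory_after A (\<alpha>' @ \<beta>') (j * n + m)"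
    and fin: "\<And>j. j < p \<Longrightarrow>
      memory_after A (\<alpha> @ \<beta>) (Suc j * n) = memory_after A (\<alpha>' @ \<beta>') (Suc j * n)"
    and "j \<le> p"
  shows "memory_after A (\<alpha> @ \<beta>') (j * n) = memory_after A (\<alpha> @ \<beta>) (j * n)"
  using \<open>j \<le> p\<close>
proof (induction j)
  case 0
  show ?case by simp
next
  case (Suc j)
  have pos: "i mod n = i - j * n" if "j * n \<le> i" "i < Suc j * n" for i
  proof -
    have "i = (i - j * n) + j * n" "i - j * n < n" using that by auto
    then show ?thesis by (metis mod_less mod_mult_self1)
  qed
  have "memory_after A (\<alpha> @ \<beta>') (j * n + m) = memory_after A (\<alpha> @ \<beta>) (j * n + m)"
  proof (rule memory_after_cong[where t = "j * n"])
    fix i assume "j * n \<le> i" "i < j * n + m"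
    then have "i mod n < m" using pos[of i] n by simp
    then show "(\<alpha> @ \<beta>') ! (i mod length (\<alpha> @ \<beta>')) = (\<alpha> @ \<beta>) ! (i mod length (\<alpha> @ \<beta>'))"
      using m n by (simp add: nth_append)
  qed (use Suc m n in auto)
  also have "\<dots> = memory_after A (\<alpha>' @ \<beta>') (j * n + m)"
    using mid Suc.prems by simp
  finally have "memory_after A (\<alpha> @ \<beta>') (Suc j * n) = memory_after A (\<alpha>' @ \<beta>') (Suc j * n)"
  proof (rule memory_after_cong[rotated 2])
    fix i assume "j * n + m \<le> i" "i < Suc j * n"
    then have "\<not> i mod n < m" using pos[of i] by simp
    then show "(\<alpha> @ \<beta>') ! (i mod length (\<alpha> @ \<beta>')) = (\<alpha>' @ \<beta>') ! (i mod length (\<alpha> @ \<beta>'))"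
      using m n by (simp add: nth_append)
  qed (use m n in auto)
  then show ?case using fin Suc.prems by simp
qed

lemma length_memory_after_le:
  "t \<le> p * length \<sigma> \<Longrightarrow> length (memory_after A \<sigma> t) \<le> memory_bits A p \<sigma>"
  unfolding memory_bits_def by (rule Max_ge) auto

text \<open>
  The exponent \<open>2 * B\<close> instead of \<open>B + 1\<close> keeps the bound tight at \<open>B = 0\<close>, so that it is still
  useful when \<open>p\<close> exceeds \<open>n\<close>.
\<close>

lemma card_bitstrings_le: "card {w :: bool list. length w \<le> B} \<le> 2 ^ (2 * B)"
proof -
  have "card {w :: bool list. length w \<le> B} = (\<Sum>i\<le>B. 2 ^ i)"
    using card_lists_length_le[of "UNIV :: bool set" B] by simp
  also have "\<dots> \<le> 2 ^ (2 * B)"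
  proof (induction B)
    case (Suc B)
    \<comment> \<open>With the induction hypothesis, the new sum is at most
      \<open>4 ^ B + 2 * 2 ^ B\<close>, hence at most \<open>3 * 4 ^ B\<close>.\<close>
    have "(2::nat) ^ B \<le> 2 ^ (2 * B)" by (rule power_increasing) auto
    moreover have "(2::nat) ^ (2 * Suc B) = 4 * 2 ^ (2 * B)" by simp
    ultimately show ?case
      using Suc unfolding sum.atMost_Suc power_Suc[of 2 B] by linarith
  qed simp
  finally show ?thesis .
qed

lemma finite_bitstrings: "finite {w :: bool list. length w \<le> B}"
  using finite_lists_length_le[of "UNIV :: bool set" B] by simp

text \<open>If two elements leave the same transcript of memory contents at the \<open>2 * p\<close>
  switches, the exchange lemma makes both mixed streams accepted, so \<open>fool\<close> identifies
  the elements. The transcript map is therefore injective, and there are at most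
  \<open>(2 ^ (2 * B)) ^ (2 * p)\<close> transcripts.\<close>

lemma card_fooling_set_le:
  fixes A :: "'i streaming_alg"
  assumes len: "\<And>x. x \<in> S \<Longrightarrow> length (\<alpha> x) = m" "\<And>x. x \<in> S \<Longrightarrow> length (\<beta> x) = l"
    and accept: "\<And>x. x \<in> S \<Longrightarrow> result A p (\<alpha> x @ \<beta> x)"
    and fool: "\<And>x y. x \<in> S \<Longrightarrow> y \<in> S \<Longrightarrow>
      result A p (\<alpha> x @ \<beta> y) \<Longrightarrow> result A p (\<alpha> y @ \<beta> x) \<Longrightarrow> x = y"
    and mem: "\<And>x. x \<in> S \<Longrightarrow> memory_bits A p (\<alpha> x @ \<beta> x) \<le> B"
  shows "card S \<le> 2 ^ (4 * p * B)"
proof -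
  define n where "n = m + l"
  \<comment> \<open>The switches from first to second part, then the ends of the passes. Time 0 is
    left out: the initial memory is the same for all streams.\<close>
  define T where "T = map (\<lambda>j. j * n + m) [0..<p] @ map (\<lambda>j. Suc j * n) [0..<p]"
  define tr where "tr x = map (memory_after A (\<alpha> x @ \<beta> x)) T" for x
  define W where "W = {w :: bool list. length w \<le> B}"
  \<comment> \<open>\<open>memory_bits\<close> bounds only the contents up to the end of pass
    \<open>p\<close>.\<close>
  have T_le: "t \<le> p * n" if "t \<in> set T" for t
  proof -
    have "\<exists>j<p. t = j * n + m \<or> t = Suc j * n"
      using that by (auto simp: T_def)
    then obtain j where "j < p" "t \<le> Suc j * n"
      by (force simp: n_def)
    then show ?thesis by (meson Suc_leI le_trans mult_le_mono1)
  qed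
  have "tr ` S \<subseteq> {ws. set ws \<subseteq> W \<and> length ws = 2 * p}"
  proof -
    have "length (memory_after A (\<alpha> x @ \<beta> x) t) \<le> B" if "x \<in> S" "t \<in> set T" for x t
      using length_memory_after_le[of t p "\<alpha> x @ \<beta> x" A] mem[OF that(1)] T_le[OF that(2)]
        len that(1) by (simp add: n_def)
    moreover have "length T = 2 * p" by (simp add: T_def)
    ultimately show ?thesis by (auto simp: tr_def W_def)
  qed
  moreover have "inj_on tr S"
  proof (rule inj_onI)
    have mixed: "result A p (\<alpha> x @ \<beta> y)" if "x \<in> S" "y \<in> S" "tr x = tr y" for x y
    proof -
      have "memory_after A (\<alpha> x @ \<beta> y) (p * n) = memory_after A (\<alpha> x @ \<beta> x) (p * n)"
      proof (rule memory_after_exchange[where p = p and m = m and \<alpha>' = "\<alpha> y"])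
      qed (use that len in \<open>auto simp: tr_def T_def n_def\<close>)
      then show ?thesis
        using accept[OF that(1)] that len by (simp add: result_def n_def)
    qed
    fix x y assume "x \<in> S" "y \<in> S" "tr x = tr y"
    then show "x = y" using fool mixed by metis
  qed
  moreover have "finite W"
    unfolding W_def by (rule finite_bitstrings)
  ultimately have "card S \<le> card {ws. set ws \<subseteq> W \<and> length ws = 2 * p}"
    by (intro card_inj_on_le finite_lists_length_eq)
  also have "\<dots> = card W ^ (2 * p)"
    using \<open>finite W\<close> by (rule card_lists_length_eq)
  also have "\<dots> \<le> (2 ^ (2 * B)) ^ (2 * p)"
    unfolding W_def by (rule power_mono[OF card_bitstrings_le]) simp
  also have "\<dots> = 2 ^ (4 * p * B)"
    by (simp flip: power_mult add: mult.commute mult.left_commute)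
  finally show ?thesis .
qed

section \<open>The hard split graphs and their streams\<close>

definition two_centre_arcs :: "nat \<Rightarrow> nat set \<Rightarrow> nat set \<Rightarrow> (nat \<times> nat) set" where
  "two_centre_arcs k X Y = X \<times> {k} \<union> insert k Y \<times> {Suc k}"

definition two_centre_graph :: "nat \<Rightarrow> nat set \<Rightarrow> nat set \<Rightarrow> nat pair_pre_digraph" where
  "two_centre_graph k X Y =
     \<lparr>pverts = {..<k + 2}, parcs = two_centre_arcs k X Y \<union> (two_centre_arcs k X Y)\<inverse>\<rparr>"

lemma pverts_two_centre_graph [simp]: "pverts (two_centre_graph k X Y) = {..<k + 2}"
  by (simp add: two_centre_graph_def)

lemma parcs_two_centre_graph:
  "(u, v) \<in> parcs (two_centre_graph k X Y) \<longleftrightarrow>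
     u \<in> X \<and> v = k \<or> (u = k \<or> u \<in> Y) \<and> v = Suc k \<or> v \<in> X \<and> u = k \<or> (v = k \<or> v \<in> Y) \<and> u = Suc k"
  by (auto simp: two_centre_graph_def two_centre_arcs_def)

lemma pair_graph_two_centre_graph:
  assumes "X \<subseteq> {..<k}" "Y \<subseteq> {..<k}"
  shows "pair_graph (two_centre_graph k X Y)"
proof -
  let ?G = "two_centre_graph k X Y"
  have sub: "parcs ?G \<subseteq> {..<k + 2} \<times> {..<k + 2}"
    using assms by (fastforce simp: parcs_two_centre_graph)
  then have "finite (parcs ?G)"
    by (rule finite_subset) simp
  moreover have "symmetric ?G"
    by (auto simp: symmetric_def sym_def parcs_two_centre_graph)
  moreover have "u \<noteq> v" if "(u, v) \<in> parcs ?G" for u v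
    using that assms by (auto simp: parcs_two_centre_graph)
  ultimately show ?thesis
    using sub by unfold_locales auto
qed

lemma two_centre_graph_in_split_graphs:
  assumes "X \<subseteq> {..<k}" "Y \<subseteq> {..<k}"
  shows "two_centre_graph k X Y \<in> split_graphs"
proof -
  have "is_split (two_centre_graph k X Y)"
    unfolding is_split_def
    by (rule exI[of _ "{k, Suc k}"], rule exI[of _ "{..<k}"])
      (use assms in \<open>auto simp: parcs_two_centre_graph\<close>)
  then show ?thesis
    using pair_graph_two_centre_graph[OF assms]
    by (simp add: split_graphs_def labelled_graphs_def)
qed

text \<open>A vertex below \<open>k\<close> outside \<open>X \<union> Y\<close> is isolated. If
  there is none, every vertex reaches \<open>k\<close> directly or through
  \<open>Suc k\<close>.\<close>

lemma connected_two_centre_graph_iff: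
  assumes "X \<subseteq> {..<k}" "Y \<subseteq> {..<k}"
  shows "connected (with_proj (two_centre_graph k X Y)) \<longleftrightarrow> X \<union> Y = {..<k}"
proof -
  let ?G = "two_centre_graph k X Y"
  interpret pair_graph ?G by (rule pair_graph_two_centre_graph[OF assms])
  have sym: "symmetric (with_proj ?G)" by (rule sym_arcs)
  \<comment> \<open>Connectedness is strong connectedness of the symmetric closure, which has the
    same reachability because the graph is already symmetric.\<close>
  have "connected (with_proj ?G) \<longleftrightarrow>
    (\<forall>u\<in>{..<k + 2}. \<forall>v\<in>{..<k + 2}. u \<rightarrow>\<^sup>*\<^bsub>with_proj ?G\<^esub> v)"
    using reachable_mk_symmetric_eq[OF sym]
    by (auto simp: connected_def strongly_connected_def)
  also have "\<dots> \<longleftrightarrow> X \<union> Y = {..<k}"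
  proof
    assume reach: "\<forall>u\<in>{..<k + 2}. \<forall>v\<in>{..<k + 2}. u \<rightarrow>\<^sup>*\<^bsub>with_proj ?G\<^esub> v"
    have "u \<in> X \<union> Y" if u: "u < k" for u
    proof -
      \<comment> \<open>Since \<open>u\<close> differs from \<open>k\<close>, the walk has a first
        arc, and its head can only be one of the two centres.\<close>
      have "u \<rightarrow>\<^sup>*\<^bsub>with_proj ?G\<^esub> k" using reach u by auto
      then obtain v where "(u, v) \<in> parcs ?G"
        using u by (cases rule: converse_reachable_cases) auto
      then show ?thesis using u by (auto simp: parcs_two_centre_graph)
    qed
    with assms show "X \<union> Y = {..<k}" by auto
  next
    assume cover: "X \<union> Y = {..<k}"
    have to_k: "u \<rightarrow>\<^sup>*\<^bsub>with_proj ?G\<^esub> k" if u: "u < k + 2" for u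
    proof -
      have Suc_k: "Suc k \<rightarrow>\<^sup>*\<^bsub>with_proj ?G\<^esub> k"
        by (rule reachable_adjI) (simp add: parcs_two_centre_graph)
      consider "u = k" | "u = Suc k" | "u \<in> X" | "u \<in> Y" using u cover by force
      then show ?thesis
      proof cases
        case 3
        then show ?thesis by (intro reachable_adjI) (simp add: parcs_two_centre_graph)
      next
        case 4
        then have "(u, Suc k) \<in> parcs ?G" by (simp add: parcs_two_centre_graph)
        then show ?thesis using Suc_k by (rule adj_reachable_trans)
      qed (use Suc_k in auto)
    qed
    then show "\<forall>u\<in>{..<k + 2}. \<forall>v\<in>{..<k + 2}. u \<rightarrow>\<^sup>*\<^bsub>with_proj ?G\<^esub> v"
      using symmetric_reachable[OF sym] reachable_trans by blast
  qed
  finally show ?thesis .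
qed

text \<open>The bracketing marks the cut of the fooling set: \<open>Y\<close> occurs only after it,
  \<open>X\<close> only before it.\<close>

lemma va_stream_two_centre_graph:
  assumes "X \<subseteq> {..<k}" "Y \<subseteq> {..<k}"
  shows "va_stream (two_centre_graph k X Y) [0..<k + 2] =
    (map (\<lambda>i. (i, {})) [0..<k] @ [(k, X)]) @ [(Suc k, insert k Y)]"
proof -
  let ?G = "two_centre_graph k X Y"
  have "va_stream ?G [0..<k + 2] = map (\<lambda>i. (i, {u. u < i \<and> (u, i) \<in> parcs ?G})) [0..<k + 2]"
    unfolding va_stream_def by (rule map_cong) (auto simp del: upt_Suc)
  also have "\<dots> = (map (\<lambda>i. (i, {})) [0..<k] @ [(k, X)]) @ [(Suc k, insert k Y)]"
    using assms by (auto simp: parcs_two_centre_graph)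
  finally show ?thesis .
qed

theorem theorem38:
  shows "\<exists>c::real. c > 0 \<and> (\<exists>N::nat. \<forall>n\<ge>N. \<forall>p\<ge>(1::nat).
    \<forall>(\<F> :: nat pair_pre_digraph set) (A :: (nat \<times> nat set) streaming_alg).
      split_graphs \<subseteq> \<F> \<and> \<F> \<subseteq> labelled_graphs \<and>
      decides_connectivity A p {G \<in> \<F>. card (pverts G) = n} \<longrightarrow>
      (\<exists>G\<in>\<F>. card (pverts G) = n \<and>
        (\<exists>vs. arrival_order G vs \<and>
          real (memory_bits A p (va_stream G vs)) \<ge> c * (real n / real p))))"
proof (rule exI[of _ "1 / 8"], intro conjI exI[of _ 5] allI impI)
  fix n p :: nat and \<F> and A :: "(nat \<times> nat set) streaming_alg"
  \<comment> \<open>The fooling set will give \<open>n - 2 \<le> 4 * p * B\<close>. With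
    \<open>B\<close> at most \<open>n / (8 * p)\<close> the right side is at most
    \<open>n / 2\<close>, which is impossible from \<open>n = 5\<close> on.\<close>
  assume n: "5 \<le> n" and p: "1 \<le> p"
  assume "split_graphs \<subseteq> \<F> \<and> \<F> \<subseteq> labelled_graphs \<and>
    decides_connectivity A p {G \<in> \<F>. card (pverts G) = n}"
  then have split: "split_graphs \<subseteq> \<F>"
    and dec: "decides_connectivity A p {G \<in> \<F>. card (pverts G) = n}" by auto
  define k where "k = n - 2"
  define vs where "vs = [0..<k + 2]"
  define \<alpha> where "\<alpha> X = map (\<lambda>i. (i, {})) [0..<k] @ [(k, X)]" for X :: "nat set"
  \<comment> \<open>The complement is built in, so that equal indices form the accepted pairs of the
    fooling set.\<close>
  define \<beta> where "\<beta> X = [(Suc k, insert k ({..<k} - X))]" for X :: "nat set"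
  define G where "G X Y = two_centre_graph k X ({..<k} - Y)" for X Y
  have card_G: "card (pverts (G X Y)) = n" for X Y
    using n by (simp add: G_def k_def)
  have order: "arrival_order (G X Y) vs" for X Y
    by (auto simp: arrival_order_def vs_def G_def simp del: upt_Suc)
  have in_F: "G X Y \<in> \<F>" if "X \<subseteq> {..<k}" for X Y
    using that split two_centre_graph_in_split_graphs[of X k] by (auto simp: G_def)
  have stream: "va_stream (G X Y) vs = \<alpha> X @ \<beta> Y" if "X \<subseteq> {..<k}" for X Y
    using that unfolding G_def vs_def \<alpha>_def \<beta>_def
    by (intro va_stream_two_centre_graph) auto
  have result_iff: "result A p (\<alpha> X @ \<beta> Y) \<longleftrightarrow> X \<union> ({..<k} - Y) = {..<k}"
    if "X \<subseteq> {..<k}" for X Y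
  proof -
    have "result A p (va_stream (G X Y) vs) \<longleftrightarrow> connected (with_proj (G X Y))"
      using dec in_F[OF that] card_G order unfolding decides_connectivity_def by blast
    then show ?thesis
      using that connected_two_centre_graph_iff[of X k] stream[OF that] by (simp add: G_def)
  qed
  show "\<exists>G\<in>\<F>. card (pverts G) = n \<and> (\<exists>vs. arrival_order G vs \<and>
    real (memory_bits A p (va_stream G vs)) \<ge> 1 / 8 * (real n / real p))"
  proof (rule ccontr)
    assume none: "\<not> ?thesis"
    have small: "real (memory_bits A p (\<alpha> X @ \<beta> X)) \<le> 1 / 8 * (real n / real p)"
      if "X \<subseteq> {..<k}" for X
    proof (rule ccontr)
      assume "\<not> ?thesis"
      then have "1 / 8 * (real n / real p) \<le> real (memory_bits A p (va_stream (G X X) vs))"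
        using stream[OF that] by simp
      then show False
        using none in_F[OF that] card_G order by blast
    qed
    \<comment> \<open>Memory sizes are natural numbers, so rounding down is harmless. For
      \<open>8 * p > n\<close> this gives \<open>B = 0\<close>, and the counting bound becomes
      \<open>2 ^ k \<le> 1\<close>.\<close>
    define B where "B = nat \<lfloor>1 / 8 * (real n / real p)\<rfloor>"
    have "card (Pow {..<k}) \<le> 2 ^ (4 * p * B)"
    proof (rule card_fooling_set_le[where \<alpha> = \<alpha> and \<beta> = \<beta> and A = A])
      show "memory_bits A p (\<alpha> X @ \<beta> X) \<le> B" if "X \<in> Pow {..<k}" for X
        using small[of X] that by (simp add: B_def le_nat_floor)
      \<comment> \<open>Acceptance of \<open>\<alpha> X @ \<beta> Y\<close> means
        \<open>Y \<subseteq> X\<close>, so the two mixed streams give both inclusions.\<close>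
      show "X = Y" if "X \<in> Pow {..<k}" "Y \<in> Pow {..<k}"
        "result A p (\<alpha> X @ \<beta> Y)" "result A p (\<alpha> Y @ \<beta> X)" for X Y
        using that result_iff[of X Y] result_iff[of Y X] by blast
    qed (auto simp: \<alpha>_def \<beta>_def result_iff[unfolded \<alpha>_def \<beta>_def, simplified])
    then have "k \<le> 4 * p * B"
      by (simp add: card_Pow)
    then have "real k \<le> 4 * real p * real B"
      by (metis of_nat_le_iff of_nat_mult of_nat_numeral)
    also have "\<dots> \<le> 4 * real p * (1 / 8 * (real n / real p))"
      unfolding B_def by (intro mult_left_mono of_nat_floor) auto
    also have "\<dots> = real n / 2" using p by simp
    finally show False using n by (simp add: k_def)
  qed
qed simp

end
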